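(* Let $R$ be a ring, $\sigma$ an endomorphism of $R$ with $\sigma(1)=1$, and $\delta$ a $\sigma$-derivation of $R$. Suppose that $R$ is right $\sigma$-reversible and satisfies the condition $(\mathcal{C}_{\sigma})$. Then: (1) if $R$ is a Baer ring, then $R[x;\sigma,\delta]$ is a Baer ring; (2) if $R$ is a quasi-Baer ring, then $R[x;\sigma,\delta]$ is a quasi-Baer ring; (3) if $R$ is a p.q.-Baer ring, then $R[x;\sigma,\delta]$ is a p.q.-Baer ring.
   Context: Rings are associative with unity, not necessarily commutative. $\sigma$ is a ring endomorphism of $R$. A $\sigma$-derivation is an additive map $\delta:R\to R$ with $\delta(ab)=\sigma(a)\delta(b)+\delta(a)b$ for all $a,b\in R$. The Ore extension $R[x;\sigma,\delta]$ consists of polynomials $\sum a_i x^i$ with coefficients in $R$ written on the left, with usual addition and multiplication determined by $xa=\sigma(a)x+\delta(a)$ for $a\in R$. Condition $(\mathcal{C}_{\sigma})$: whenever $a\sigma(b)=0$ with $a,b\in R$, then $ab=0$. $R$ is right $\sigma$-reversible if whenever $ab=0$ for $a,b\in R$, then $b\sigma(a)=0$. For a nonempty subset $X$ of a ring $S$, the right annihilator of $X$ is $r_S(X)=\{c\in S: dc=0 \text{ for all } d\in X\}$; left annihilators are defined similarly. $S$ is Baer if the right annihilator of every nonempty subset is generated (as a right ideal) by an idempotent. $S$ is quasi-Baer if the right annihilator of every right ideal is generated (as a right ideal) by an idempotent. (Both notions are left-right symmetric.) $S$ is right p.q.-Baer if the right annihilator of every principal right ideal is generated (as a right ideal) by an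 idempotent; left p.q.-Baer rings are defined similarly (the left annihilator of every principal left ideal is generated as a left ideal by an idempotent); $S$ is p.q.-Baer if it is both right and left p.q.-Baer. *)

theory Defs
  imports "HOL-Algebra.UnivPoly"
begin

section \<open>One-sided ideals and annihilators\<close>

text \<open>HOL-Algebra only provides two-sided ideals.\<close>

definition right_ideal :: "'a set \<Rightarrow> ('a, 'm) ring_scheme \<Rightarrow> bool" where
  "right_ideal I S \<longleftrightarrow>
     additive_subgroup I S \<and> (\<forall>a\<in>I. \<forall>s\<in>carrier S. a \<otimes>\<^bsub>S\<^esub> s \<in> I)"

definition left_ideal :: "'a set \<Rightarrow> ('a, 'm) ring_scheme \<Rightarrow> bool" where
  "left_ideal I S \<longleftrightarrow>
     additive_subgroup I S \<and> (\<forall>a\<in>I. \<forall>s\<in>carrier S. s \<otimes>\<^bsub>S\<^esub> a \<in> I)"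

definition right_ideal_gen :: "('a, 'm) ring_scheme \<Rightarrow> 'a set \<Rightarrow> 'a set" where
  "right_ideal_gen S X = \<Inter>{I. right_ideal I S \<and> X \<subseteq> I}"

definition left_ideal_gen :: "('a, 'm) ring_scheme \<Rightarrow> 'a set \<Rightarrow> 'a set" where
  "left_ideal_gen S X = \<Inter>{I. left_ideal I S \<and> X \<subseteq> I}"

definition right_ann :: "('a, 'm) ring_scheme \<Rightarrow> 'a set \<Rightarrow> 'a set" where
  "right_ann S X = {c \<in> carrier S. \<forall>d\<in>X. d \<otimes>\<^bsub>S\<^esub> c = \<zero>\<^bsub>S\<^esub>}"

definition left_ann :: "('a, 'm) ring_scheme \<Rightarrow> 'a set \<Rightarrow> 'a set" where
  "left_ann S X = {c \<in> carrier S. \<forall>d\<in>X. c \<otimes>\<^bsub>S\<^esub> d = \<zero>\<^bsub>S\<^esub>}"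

definition idempotents :: "('a, 'm) ring_scheme \<Rightarrow> 'a set" where
  "idempotents S = {e \<in> carrier S. e \<otimes>\<^bsub>S\<^esub> e = e}"

lemma (in ring) right_ideal_gen_singleton:
  assumes a: "a \<in> carrier R"
  shows "right_ideal_gen R {a} = {a \<otimes> s | s. s \<in> carrier R}"
proof -
  let ?P = "{a \<otimes> s | s. s \<in> carrier R}"
  have "additive_subgroup ?P R"
  proof (rule additive_subgroup.intro, rule add.subgroupI)
    show "?P \<subseteq> carrier R" using a by auto
    show "?P \<noteq> {}" by blast
    fix u assume "u \<in> ?P"
    then obtain s where s: "s \<in> carrier R" "u = a \<otimes> s" by blast
    then have "\<ominus> u = a \<otimes> (\<ominus> s)" using a by (simp add: r_minus)
    then show "\<ominus> u \<in> ?P" using s by blast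
    fix v assume "v \<in> ?P"
    then obtain t where t: "t \<in> carrier R" "v = a \<otimes> t" by blast
    then have "u \<oplus> v = a \<otimes> (s \<oplus> t)" using a s by (simp add: r_distr)
    then show "u \<oplus> v \<in> ?P" using s t by blast
  qed
  moreover have "u \<otimes> t \<in> ?P" if "u \<in> ?P" "t \<in> carrier R" for u t
  proof -
    obtain s where s: "s \<in> carrier R" "u = a \<otimes> s" using \<open>u \<in> ?P\<close> by blast
    then have "u \<otimes> t = a \<otimes> (s \<otimes> t)" using a that by (simp add: m_assoc)
    then show ?thesis using s that by blast
  qed
  ultimately have "right_ideal ?P R" unfolding right_ideal_def by blast
  moreover have "{a} \<subseteq> ?P" using a r_one[OF a] one_closed by (metis (mono_tags, lifting) empty_subsetI insert_subset mem_Collect_eq)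
  ultimately show ?thesis
    unfolding right_ideal_gen_def right_ideal_def by blast
qed

lemma (in ring) left_ideal_gen_singleton:
  assumes a: "a \<in> carrier R"
  shows "left_ideal_gen R {a} = {s \<otimes> a | s. s \<in> carrier R}"
proof -
  let ?P = "{s \<otimes> a | s. s \<in> carrier R}"
  have "additive_subgroup ?P R"
  proof (rule additive_subgroup.intro, rule add.subgroupI)
    show "?P \<subseteq> carrier R" using a by auto
    show "?P \<noteq> {}" by blast
    fix u assume "u \<in> ?P"
    then obtain s where s: "s \<in> carrier R" "u = s \<otimes> a" by blast
    then have "\<ominus> u = (\<ominus> s) \<otimes> a" using a by (simp add: l_minus)
    then show "\<ominus> u \<in> ?P" using s by blast
    fix v assume "v \<in> ?P"
    then obtain t where t: "t \<in> carrier R" "v = t \<otimes> a" by blast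
    then have "u \<oplus> v = (s \<oplus> t) \<otimes> a" using a s by (simp add: l_distr)
    then show "u \<oplus> v \<in> ?P" using s t by blast
  qed
  moreover have "t \<otimes> u \<in> ?P" if "u \<in> ?P" "t \<in> carrier R" for u t
  proof -
    obtain s where s: "s \<in> carrier R" "u = s \<otimes> a" using \<open>u \<in> ?P\<close> by blast
    then have "t \<otimes> u = (t \<otimes> s) \<otimes> a" using a that by (simp add: m_assoc)
    then show ?thesis using s that by blast
  qed
  ultimately have "left_ideal ?P R" unfolding left_ideal_def by blast
  moreover have "{a} \<subseteq> ?P" using a l_one[OF a] one_closed by (metis (mono_tags, lifting) empty_subsetI insert_subset mem_Collect_eq)
  ultimately show ?thesis
    unfolding left_ideal_gen_def left_ideal_def by blast
qed


section \<open>Baer-type conditions\<close>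

definition Baer_ring :: "('a, 'm) ring_scheme \<Rightarrow> bool" where
  "Baer_ring S \<longleftrightarrow> ring S \<and>
     (\<forall>X. X \<subseteq> carrier S \<and> X \<noteq> {} \<longrightarrow>
        (\<exists>e\<in>idempotents S. right_ann S X = right_ideal_gen S {e}))"

definition quasi_Baer_ring :: "('a, 'm) ring_scheme \<Rightarrow> bool" where
  "quasi_Baer_ring S \<longleftrightarrow> ring S \<and>
     (\<forall>I. right_ideal I S \<longrightarrow>
        (\<exists>e\<in>idempotents S. right_ann S I = right_ideal_gen S {e}))"

definition right_pq_Baer_ring :: "('a, 'm) ring_scheme \<Rightarrow> bool" where
  "right_pq_Baer_ring S \<longleftrightarrow> ring S \<and>
     (\<forall>a\<in>carrier S.
        \<exists>e\<in>idempotents S. right_ann S (right_ideal_gen S {a}) = right_ideal_gen S {e})"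

definition left_pq_Baer_ring :: "('a, 'm) ring_scheme \<Rightarrow> bool" where
  "left_pq_Baer_ring S \<longleftrightarrow> ring S \<and>
     (\<forall>a\<in>carrier S.
        \<exists>e\<in>idempotents S. left_ann S (left_ideal_gen S {a}) = left_ideal_gen S {e})"

definition pq_Baer_ring :: "('a, 'm) ring_scheme \<Rightarrow> bool" where
  "pq_Baer_ring S \<longleftrightarrow> right_pq_Baer_ring S \<and> left_pq_Baer_ring S"


section \<open>Conditions relating a ring and an endomorphism\<close>

definition sigma_derivation ::
  "('a, 'm) ring_scheme \<Rightarrow> ('a \<Rightarrow> 'a) \<Rightarrow> ('a \<Rightarrow> 'a) \<Rightarrow> bool" where
  "sigma_derivation R \<sigma> \<delta> \<longleftrightarrow>
     \<delta> \<in> carrier R \<rightarrow> carrier R \<and>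
     (\<forall>a\<in>carrier R. \<forall>b\<in>carrier R. \<delta> (a \<oplus>\<^bsub>R\<^esub> b) = \<delta> a \<oplus>\<^bsub>R\<^esub> \<delta> b) \<and>
     (\<forall>a\<in>carrier R. \<forall>b\<in>carrier R.
        \<delta> (a \<otimes>\<^bsub>R\<^esub> b) = \<sigma> a \<otimes>\<^bsub>R\<^esub> \<delta> b \<oplus>\<^bsub>R\<^esub> \<delta> a \<otimes>\<^bsub>R\<^esub> b)"

definition condition_C :: "('a, 'm) ring_scheme \<Rightarrow> ('a \<Rightarrow> 'a) \<Rightarrow> bool" where
  "condition_C R \<sigma> \<longleftrightarrow>
     (\<forall>a\<in>carrier R. \<forall>b\<in>carrier R.
        a \<otimes>\<^bsub>R\<^esub> \<sigma> b = \<zero>\<^bsub>R\<^esub> \<longrightarrow> a \<otimes>\<^bsub>R\<^esub> b = \<zero>\<^bsub>R\<^esub>)"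

definition right_sigma_reversible :: "('a, 'm) ring_scheme \<Rightarrow> ('a \<Rightarrow> 'a) \<Rightarrow> bool" where
  "right_sigma_reversible R \<sigma> \<longleftrightarrow>
     (\<forall>a\<in>carrier R. \<forall>b\<in>carrier R.
        a \<otimes>\<^bsub>R\<^esub> b = \<zero>\<^bsub>R\<^esub> \<longrightarrow> b \<otimes>\<^bsub>R\<^esub> \<sigma> a = \<zero>\<^bsub>R\<^esub>)"


section \<open>Ore extensions\<close>

text \<open>
  Left multiplication by \<open>x\<close>, read off from \<open>x a = \<sigma>(a) x + \<delta>(a)\<close>:
  \<open>x (\<Sum>\<^sub>j b\<^sub>j x\<^sup>j) = \<Sum>\<^sub>j (\<sigma>(b\<^sub>j) x\<^bsup>j+1\<^esup> + \<delta>(b\<^sub>j) x\<^sup>j)\<close>.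
\<close>

definition ore_X_mult ::
  "('a, 'm) ring_scheme \<Rightarrow> ('a \<Rightarrow> 'a) \<Rightarrow> ('a \<Rightarrow> 'a) \<Rightarrow> (nat \<Rightarrow> 'a) \<Rightarrow> nat \<Rightarrow> 'a" where
  "ore_X_mult R \<sigma> \<delta> g n =
     (case n of 0 \<Rightarrow> \<delta> (g 0) | Suc m \<Rightarrow> \<sigma> (g m) \<oplus>\<^bsub>R\<^esub> \<delta> (g (Suc m)))"

text \<open>The product is \<open>(\<Sum>\<^sub>i a\<^sub>i x\<^sup>i) g = \<Sum>\<^sub>i a\<^sub>i (x\<^sup>i g)\<close>.\<close>

definition ore_mult ::
  "('a, 'm) ring_scheme \<Rightarrow> ('a \<Rightarrow> 'a) \<Rightarrow> ('a \<Rightarrow> 'a) \<Rightarrow>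
    (nat \<Rightarrow> 'a) \<Rightarrow> (nat \<Rightarrow> 'a) \<Rightarrow> nat \<Rightarrow> 'a" where
  "ore_mult R \<sigma> \<delta> f g n =
     (\<Oplus>\<^bsub>R\<^esub>i\<in>{i. f i \<noteq> \<zero>\<^bsub>R\<^esub>}. f i \<otimes>\<^bsub>R\<^esub> (ore_X_mult R \<sigma> \<delta> ^^ i) g n)"

text \<open>
  Carrier, addition, zero, one and the left \<open>R\<close>-module structure are those of the
  ordinary polynomials \<open>UP R\<close>; a polynomial with left coefficients \<open>a\<^sub>i\<close> is
  the finitely supported sequence \<open>i \<mapsto> a\<^sub>i\<close>.
\<close>

definition ore_extension ::
  "('a, 'm) ring_scheme \<Rightarrow> ('a \<Rightarrow> 'a) \<Rightarrow> ('a \<Rightarrow> 'a) \<Rightarrow> ('a, nat \<Rightarrow> 'a) up_ring" where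
  "ore_extension R \<sigma> \<delta> = (UP R)\<lparr>mult := ore_mult R \<sigma> \<delta>\<rparr>"

locale ore_data = ring R for R (structure) +
  fixes \<sigma> \<delta> :: "'a \<Rightarrow> 'a"
  assumes sigma_hom: "\<sigma> \<in> ring_hom R R"
    and delta_der: "sigma_derivation R \<sigma> \<delta>"
begin

abbreviation "T \<equiv> ore_X_mult R \<sigma> \<delta>"
abbreviation "M \<equiv> ore_mult R \<sigma> \<delta>"
abbreviation "A \<equiv> (\<lambda>f g (n::nat). f n \<oplus> g n)"
abbreviation "S \<equiv> (\<lambda>a f (n::nat). a \<otimes> f n)"
abbreviation "mnm \<equiv> (\<lambda>a (k::nat) n. if n = k then a else \<zero>)"

lemma sc [simp]: "a \<in> carrier R \<Longrightarrow> \<sigma> a \<in> carrier R"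
  using sigma_hom by (rule ring_hom_closed)
lemma dc [simp]: "a \<in> carrier R \<Longrightarrow> \<delta> a \<in> carrier R"
  using delta_der unfolding sigma_derivation_def by blast
lemma s_add: "a \<in> carrier R \<Longrightarrow> b \<in> carrier R \<Longrightarrow> \<sigma> (a \<oplus> b) = \<sigma> a \<oplus> \<sigma> b"
  using sigma_hom by (rule ring_hom_add)
lemma s_mult: "a \<in> carrier R \<Longrightarrow> b \<in> carrier R \<Longrightarrow> \<sigma> (a \<otimes> b) = \<sigma> a \<otimes> \<sigma> b"
  using sigma_hom by (rule ring_hom_mult)
lemma s_one [simp]: "\<sigma> \<one> = \<one>"
  using sigma_hom by (rule ring_hom_one)
lemma d_add: "a \<in> carrier R \<Longrightarrow> b \<in> carrier R \<Longrightarrow> \<delta> (a \<oplus> b) = \<delta> a \<oplus> \<delta> b"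
  using delta_der unfolding sigma_derivation_def by blast
lemma d_mult: "a \<in> carrier R \<Longrightarrow> b \<in> carrier R \<Longrightarrow> \<delta> (a \<otimes> b) = \<sigma> a \<otimes> \<delta> b \<oplus> \<delta> a \<otimes> b"
  using delta_der unfolding sigma_derivation_def by blast
lemma s_zero [simp]: "\<sigma> \<zero> = \<zero>"
  by (metis add.l_cancel_one' s_add sc zero_closed l_zero)
lemma d_zero [simp]: "\<delta> \<zero> = \<zero>"
  by (metis add.l_cancel_one' d_add dc zero_closed l_zero)
lemma d_one [simp]: "\<delta> \<one> = \<zero>"
  by (metis add.l_cancel_one' d_mult dc one_closed l_one r_one s_one)

lemma T_0: "T g 0 = \<delta> (g 0)"
  and T_Suc: "T g (Suc n) = \<sigma> (g n) \<oplus> \<delta> (g (Suc n))"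
  by (simp_all add: ore_X_mult_def)

lemma upc [simp]: "f \<in> up R \<Longrightarrow> f n \<in> carrier R" by (rule mem_upD)

lemma A_up [simp]: "f \<in> up R \<Longrightarrow> g \<in> up R \<Longrightarrow> A f g \<in> up R" by (rule up_add_closed)
lemma S_up [simp]: "a \<in> carrier R \<Longrightarrow> g \<in> up R \<Longrightarrow> S a g \<in> up R" by (rule up_smult_closed)
lemma zero_up [simp]: "(\<lambda>n. \<zero>) \<in> up R" by auto
lemma mon_up [simp]: "a \<in> carrier R \<Longrightarrow> mnm a k \<in> up R"
  by (rule mem_upI) auto

lemma T_up [simp]:
  assumes "f \<in> up R" shows "T f \<in> up R"
proof (rule mem_upI)
  show "T f n \<in> carrier R" for n using assms by (cases n) (auto simp: T_0 T_Suc)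
  obtain N where N: "bound \<zero> N f" using assms by auto
  have "T f m = \<zero>" if "Suc N < m" for m
    using N that by (cases m) (auto simp: T_Suc bound_def)
  then show "\<exists>n. bound \<zero> n (T f)" by blast
qed

lemma Ti_up [simp]: "f \<in> up R \<Longrightarrow> (T ^^ i) f \<in> up R"
  by (induction i) auto

lemma T_A: "f \<in> up R \<Longrightarrow> g \<in> up R \<Longrightarrow> T (A f g) = A (T f) (T g)"
proof
  fix n assume "f \<in> up R" "g \<in> up R"
  then show "T (A f g) n = T f n \<oplus> T g n"
    by (cases n) (simp_all add: T_0 T_Suc s_add d_add a_ac)
qed

lemma T_S: "a \<in> carrier R \<Longrightarrow> g \<in> up R \<Longrightarrow> T (S a g) = A (S (\<sigma> a) (T g)) (S (\<delta> a) g)"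
proof
  fix n assume "a \<in> carrier R" "g \<in> up R"
  then show "T (S a g) n = \<sigma> a \<otimes> T g n \<oplus> \<delta> a \<otimes> g n"
    by (cases n) (simp_all add: T_0 T_Suc s_mult d_mult r_distr a_ac)
qed

lemma Ti_A: "f \<in> up R \<Longrightarrow> g \<in> up R \<Longrightarrow> (T ^^ i) (A f g) = A ((T ^^ i) f) ((T ^^ i) g)"
  by (induction i) (simp_all add: T_A)

lemma T_zero: "T (\<lambda>n. \<zero>) = (\<lambda>n. \<zero>)"
proof
  show "T (\<lambda>n. \<zero>) n = \<zero>" for n by (cases n) (simp_all add: T_0 T_Suc)
qed

lemma T_mnm: "a \<in> carrier R \<Longrightarrow> T (mnm a k) = A (mnm (\<sigma> a) (Suc k)) (mnm (\<delta> a) k)"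
proof
  fix n assume "a \<in> carrier R"
  then show "T (mnm a k) n = mnm (\<sigma> a) (Suc k) n \<oplus> mnm (\<delta> a) k n"
    by (cases n) (auto simp: T_0 T_Suc)
qed

lemma M_bound:
  assumes "f \<in> up R" "g \<in> up R" "bound \<zero> N f"
  shows "M f g n = (\<Oplus>i\<in>{..N}. f i \<otimes> (T ^^ i) g n)"
proof -
  have "{i. f i \<noteq> \<zero>} \<subseteq> {..N}"
    using assms(3) by (auto simp: bound_def) (meson not_le)
  then show ?thesis
    unfolding ore_mult_def using assms
    by (intro add.finprod_mono_neutral_cong_left) auto
qed

lemma bound_mono: "bound \<zero> N f \<Longrightarrow> N \<le> K \<Longrightarrow> bound \<zero> K f"
  by (auto simp: bound_def)

lemma M_A_left:
  assumes "f \<in> up R" "f' \<in> up R" "g \<in> up R"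
  shows "M (A f f') g = A (M f g) (M f' g)"
proof
  fix n
  obtain N N' where "bound \<zero> N f" "bound \<zero> N' f'" using assms by blast
  then have b: "bound \<zero> (max N N') f" "bound \<zero> (max N N') f'"
    by (auto intro: bound_mono)
  then have "bound \<zero> (max N N') (A f f')" by (auto simp: bound_def)
  then show "M (A f f') g n = M f g n \<oplus> M f' g n"
    using b assms by (simp add: M_bound[where N = "max N N'"] l_distr)
qed

lemma M_A_right:
  assumes "f \<in> up R" "g \<in> up R" "g' \<in> up R"
  shows "M f (A g g') = A (M f g) (M f g')"
proof
  fix n
  obtain N where "bound \<zero> N f" using assms by blast
  then show "M f (A g g') n = M f g n \<oplus> M f g' n"
    using assms by (simp add: M_bound[where N = N] Ti_A r_distr)
qed

lemma M_S:
  assumes "a \<in> carrier R" "f \<in> up R" "g \<in> up R"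
  shows "M (S a f) g = S a (M f g)"
proof
  fix n
  obtain N where b: "bound \<zero> N f" using assms by blast
  then have "bound \<zero> N (S a f)" using assms by (auto simp: bound_def)
  then show "M (S a f) g n = a \<otimes> M f g n"
    using b assms by (simp add: M_bound[where N = N] m_assoc finsum_rdistr Pi_def)
qed

lemma M_zero: "M (\<lambda>n. \<zero>) g = (\<lambda>n. \<zero>)"
  by (simp add: ore_mult_def fun_eq_iff)

lemma M_mnm:
  assumes "a \<in> carrier R" "g \<in> up R"
  shows "M (mnm a k) g = S a ((T ^^ k) g)"
proof
  fix n
  show "M (mnm a k) g n = a \<otimes> (T ^^ k) g n"
  proof (cases "a = \<zero>")
    case True
    then show ?thesis using assms by (simp add: ore_mult_def)
  next
    case False
    then have "{i. mnm a k i \<noteq> \<zero>} = {k}" by auto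
    then have "M (mnm a k) g n = (\<Oplus>i\<in>{k}. mnm a k i \<otimes> (T ^^ i) g n)"
      unfolding ore_mult_def by simp
    then show ?thesis using assms by simp
  qed
qed

lemma up_poly_induct [consumes 1, case_names zero step]:
  assumes "f \<in> up R"
    and z: "P (\<lambda>n. \<zero>)"
    and st: "\<And>g a k. g \<in> up R \<Longrightarrow> a \<in> carrier R \<Longrightarrow> P g \<Longrightarrow> P (A (mnm a k) g)"
  shows "P f"
proof -
  have "\<forall>f. f \<in> up R \<longrightarrow> (\<forall>n\<ge>N. f n = \<zero>) \<longrightarrow> P f" for N
  proof (induction N)
    case 0
    then show ?case using z by (auto simp: fun_eq_iff[symmetric])
  next
    case (Suc N)
    show ?case
    proof (intro allI impI)
      fix f assume f: "f \<in> up R" "\<forall>n\<ge>Suc N. f n = \<zero>"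
      define g where "g n = (if n < N then f n else \<zero>)" for n
      have gu: "g \<in> up R"
      proof (rule mem_upI)
        show "g n \<in> carrier R" for n using f by (simp add: g_def)
        have "bound \<zero> N g" by (auto simp: g_def)
        then show "\<exists>n. bound \<zero> n g" by blast
      qed
      moreover have "\<forall>n\<ge>N. g n = \<zero>" by (auto simp: g_def)
      ultimately have "P (A (mnm (f N) N) g)" using Suc st f by auto
      moreover have "A (mnm (f N) N) g = f"
      proof
        fix n show "A (mnm (f N) N) g n = f n"
          using f by (cases n N rule: linorder_cases) (auto simp: g_def)
      qed
      ultimately show "P f" by simp
    qed
  qed
  moreover obtain N where "bound \<zero> N f" using assms(1) by blast
  then have "\<forall>n\<ge>Suc N. f n = \<zero>" by (auto simp: bound_def)
  ultimately show ?thesis using assms(1) by blast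
qed

lemma M_up [simp]:
  assumes "f \<in> up R" "g \<in> up R"
  shows "M f g \<in> up R"
  using assms(1) by (induction rule: up_poly_induct) (use assms(2) in \<open>simp_all add: M_zero M_A_left M_mnm\<close>)

lemma M_T:
  assumes "f \<in> up R" "g \<in> up R"
  shows "M (T f) g = T (M f g)"
  using assms(1)
proof (induction rule: up_poly_induct)
  case zero
  then show ?case by (simp add: M_zero T_zero)
next
  case (step h a k)
  then show ?case using assms(2) by (simp add: M_A_left T_A M_mnm T_mnm T_S)
qed

lemma M_Ti: "f \<in> up R \<Longrightarrow> g \<in> up R \<Longrightarrow> M ((T ^^ i) f) g = (T ^^ i) (M f g)"
  by (induction i) (simp_all add: M_T)

lemma M_assoc:
  assumes "f \<in> up R" "g \<in> up R" "h \<in> up R"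
  shows "M (M f g) h = M f (M g h)"
  using assms(1)
proof (induction rule: up_poly_induct)
  case zero
  then show ?case by (simp add: M_zero)
next
  case (step f a k)
  then show ?case using assms by (simp add: M_A_left M_mnm M_S M_Ti)
qed

lemma Ti_one: "(T ^^ i) (mnm \<one> 0) = mnm \<one> i"
proof (induction i)
  case 0
  then show ?case by simp
next
  case (Suc i)
  then show ?case by (simp add: T_mnm) (auto simp: fun_eq_iff)
qed

lemma M_one_right: "f \<in> up R \<Longrightarrow> M f (mnm \<one> 0) = f"
proof (induction rule: up_poly_induct)
  case zero
  then show ?case by (simp add: M_zero)
next
  case (step g a k)
  then show ?case by (simp add: M_A_left M_mnm Ti_one) (auto simp: fun_eq_iff)
qed

lemma M_one_left: "f \<in> up R \<Longrightarrow> M (mnm \<one> 0) f = f"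
  by (simp add: M_mnm)

abbreviation "E \<equiv> ore_extension R \<sigma> \<delta>"

lemma ring_E: "ring E"
proof (rule ringI)
  interpret U: UP_ring R "UP R" by unfold_locales
  have "abelian_group (UP R)" using U.UP_ring by (rule ring.is_abelian_group)
  then show "abelian_group E"
    unfolding ore_extension_def
    by (auto simp: abelian_group_def abelian_monoid_def abelian_group_axioms_def)
  show "monoid E"
    by (rule monoidI) (auto simp: ore_extension_def UP_def M_assoc M_one_left M_one_right)
qed (simp_all add: ore_extension_def UP_def M_A_left M_A_right)

end

theorem ore_extension_ring:
  assumes "ring R" "\<sigma> \<in> ring_hom R R" "sigma_derivation R \<sigma> \<delta>"
  shows "ring (ore_extension R \<sigma> \<delta>)"
  using assms by (intro ore_data.ring_E ore_data.intro ore_data_axioms.intro)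

text \<open>The defining relation \<open>x a = \<sigma>(a) x + \<delta>(a)\<close>.\<close>

theorem ore_extension_X_mult_const:
  fixes R (structure)
  assumes "ring R" "\<sigma> \<in> ring_hom R R" "sigma_derivation R \<sigma> \<delta>" "a \<in> carrier R"
  defines "E \<equiv> ore_extension R \<sigma> \<delta>"
  shows "monom E \<one> 1 \<otimes>\<^bsub>E\<^esub> monom E a 0 =
         monom E (\<sigma> a) 1 \<oplus>\<^bsub>E\<^esub> monom E (\<delta> a) 0"
proof -
  interpret ore_data R \<sigma> \<delta>
    using assms by (intro ore_data.intro ore_data_axioms.intro)
  have [simp]: "mnm b k \<in> up R" if "b \<in> carrier R" for b k using that by (rule mon_up)
  have "M (mnm \<one> 1) (mnm a 0) = A (mnm (\<sigma> a) 1) (mnm (\<delta> a) 0)"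
    using assms by (simp add: M_mnm T_mnm)
  then show ?thesis
    using assms(4) by (simp add: E_def ore_extension_def UP_def)
qed

text \<open>Together with the relation above and associativity, this determines the product:
  \<open>(a x\<^sup>i) (b x\<^sup>j) = a ((x\<^sup>i b) x\<^sup>j)\<close>, where \<open>a x\<^sup>i\<close> is indeed a product.\<close>

theorem ore_extension_monom:
  fixes R (structure)
  assumes "ring R" "\<sigma> \<in> ring_hom R R" "sigma_derivation R \<sigma> \<delta>" "a \<in> carrier R"
  defines "E \<equiv> ore_extension R \<sigma> \<delta>"
  shows "monom E a n = monom E a 0 \<otimes>\<^bsub>E\<^esub> (monom E \<one> 1 [^]\<^bsub>E\<^esub> n)"
proof -
  interpret ore_data R \<sigma> \<delta>
    using assms by (intro ore_data.intro ore_data_axioms.intro)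
  interpret E: ring E unfolding E_def by (rule ring_E)
  have mn: "monom E b k = mnm b k" if "b \<in> carrier R" for b k
    using that by (simp add: E_def ore_extension_def UP_def)
  have mu: "f \<otimes>\<^bsub>E\<^esub> g = M f g" for f g
    by (simp add: E_def ore_extension_def)
  have one: "\<one>\<^bsub>E\<^esub> = mnm \<one> 0"
    by (simp add: E_def ore_extension_def UP_def)
  have "mnm \<one> 1 [^]\<^bsub>E\<^esub> n = mnm \<one> n"
  proof (induction n)
    case 0
    then show ?case by (simp add: one)
  next
    case (Suc n)
    have "M (mnm \<one> n) (mnm \<one> 1) = S \<one> ((T ^^ n) ((T ^^ 1) (mnm \<one> 0)))"
      by (subst Ti_one) (rule M_mnm; simp)
    also have "\<dots> = (T ^^ Suc n) (mnm \<one> 0)"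
      by (simp add: funpow_swap1)
    also have "\<dots> = mnm \<one> (Suc n)" by (rule Ti_one)
    finally show ?case using Suc by (simp only: E.nat_pow_Suc mu)
  qed
  then show ?thesis
    using assms(4) by (simp add: mn mu M_mnm) (auto simp: fun_eq_iff)
qed

end

theory Submission
  imports Defs
begin

text \<open>
  Right \<open>\<sigma>\<close>-reversibility turns \<open>a b = 0\<close> into \<open>b \<sigma>(a) = 0\<close>, and the condition that \<open>a \<sigma>(b) = 0\<close>
  implies \<open>a b = 0\<close> then removes \<open>\<sigma>\<close>.  So \<open>R\<close> is reversible (\<open>a b = 0\<close> implies \<open>b a = 0\<close>), and
  \<open>a \<sigma>(b) = 0\<close> is equivalent to \<open>a b = 0\<close>.  In a reversible ring, idempotents are central, and a
  set and the one-sided ideals that it generates have the same annihilator, on either side.  Each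
  of the Baer-type conditions therefore just says that the annihilators of certain sets are
  generated by idempotents: all sets for Baer and for quasi-Baer, singletons (equivalently, finite
  sets) for p.q.-Baer.  Already the condition for singletons forces \<open>R\<close> to be reduced.

  In a reduced ring the equivalence above also yields that \<open>a b = 0\<close> implies \<open>a \<delta>(b) = 0\<close>, and
  from this the Ore extension satisfies an Armendariz property (\<open>M_eq_zero_iff\<close>): a product
  \<open>f g\<close> vanishes exactly when every coefficient of \<open>f\<close> annihilates every coefficient of \<open>g\<close>.
  Hence the Ore extension is reduced too, so that its Baer-type conditions simplify in the same
  way, and the annihilator of a set \<open>X\<close> of polynomials consists of the polynomials whose
  coefficients annihilate the set \<open>C\<close> of all coefficients of members of \<open>X\<close>.  If the annihilator
  of \<open>C\<close> in \<open>R\<close> is \<open>e R\<close>, then that of \<open>X\<close> is generated by the constant polynomial \<open>e\<close>.  For a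
  single polynomial, \<open>C\<close> is finite, which is what the p.q.-Baer case needs.
\<close>

section \<open>Annihilators in reversible rings\<close>

definition idempotent_annihilator :: "('a, 'm) ring_scheme \<Rightarrow> 'a set \<Rightarrow> bool" where
  "idempotent_annihilator S X \<longleftrightarrow>
     (\<exists>e\<in>idempotents S. right_ann S X = right_ideal_gen S {e})"

locale reversible_ring = ring R for R (structure) +
  assumes reversible:
    "a \<in> carrier R \<Longrightarrow> b \<in> carrier R \<Longrightarrow> a \<otimes> b = \<zero> \<Longrightarrow> b \<otimes> a = \<zero>"
begin

text \<open>Reversing gives \<open>b a = 0\<close>, so \<open>b (a s) = 0\<close>; then reverse again.\<close>

lemma insert_middle:
  assumes "a \<in> carrier R" "b \<in> carrier R" "s \<in> carrier R" "a \<otimes> b = \<zero>"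
  shows "a \<otimes> s \<otimes> b = \<zero>"
proof -
  have "b \<otimes> (a \<otimes> s) = \<zero>"
    using assms reversible[of a b] by (simp flip: m_assoc)
  then show ?thesis using assms reversible[of b "a \<otimes> s"] by simp
qed

text \<open>Both \<open>e (1 - e)\<close> and \<open>(1 - e) e\<close> vanish, hence so do \<open>e s (1 - e)\<close> and \<open>(1 - e) s e\<close>.
  Thus \<open>e s = e s e = s e\<close>.\<close>

lemma idempotent_central:
  assumes "e \<in> idempotents R" "s \<in> carrier R"
  shows "e \<otimes> s = s \<otimes> e"
proof -
  have e: "e \<in> carrier R" "e \<otimes> e = e" using assms by (auto simp: idempotents_def)
  let ?f = "\<one> \<ominus> e"
  have f: "?f \<in> carrier R" using e by simp
  have "e \<otimes> ?f = \<zero>" "?f \<otimes> e = \<zero>"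
    using e by (simp_all add: minus_eq r_distr l_distr r_minus l_minus r_neg)
  then have "e \<otimes> s \<otimes> ?f = \<zero>" "?f \<otimes> s \<otimes> e = \<zero>"
    using insert_middle[of e ?f s] insert_middle[of ?f e s] e f assms(2) by auto
  moreover have "e \<otimes> s \<otimes> ?f = e \<otimes> s \<ominus> e \<otimes> s \<otimes> e"
    using e assms(2) by (simp add: minus_eq r_distr r_minus)
  moreover have "?f \<otimes> s \<otimes> e = s \<otimes> e \<ominus> e \<otimes> s \<otimes> e"
    using e assms(2) by (simp add: minus_eq l_distr l_minus)
  ultimately have "e \<otimes> s \<ominus> e \<otimes> s \<otimes> e = \<zero>" "s \<otimes> e \<ominus> e \<otimes> s \<otimes> e = \<zero>"
    by simp_all
  then have "e \<otimes> s = e \<otimes> s \<otimes> e" "s \<otimes> e = e \<otimes> s \<otimes> e"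
    using e assms(2) minus_equality[of "e \<otimes> s" "\<ominus> (e \<otimes> s \<otimes> e)"]
      minus_equality[of "s \<otimes> e" "\<ominus> (e \<otimes> s \<otimes> e)"] by (simp_all add: minus_eq)
  then show ?thesis by simp
qed

lemma idempotent_right_ideal_gen:
  assumes "e \<in> idempotents R"
  shows "right_ideal_gen R {e} = {s \<in> carrier R. e \<otimes> s = s}"
proof -
  have e: "e \<in> carrier R" "e \<otimes> e = e" using assms by (auto simp: idempotents_def)
  then have "e \<otimes> (e \<otimes> s) = e \<otimes> s" if "s \<in> carrier R" for s
    using that by (simp flip: m_assoc)
  then show ?thesis using e by (auto simp: right_ideal_gen_singleton) metis
qed

lemma idempotent_left_ideal_gen:
  assumes "e \<in> idempotents R"
  shows "left_ideal_gen R {e} = right_ideal_gen R {e}"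
proof -
  have "e \<in> carrier R" using assms by (auto simp: idempotents_def)
  then show ?thesis
    using idempotent_central[OF assms]
    by (auto simp: right_ideal_gen_singleton left_ideal_gen_singleton) metis+
qed

lemma left_ann_eq_right_ann: "X \<subseteq> carrier R \<Longrightarrow> left_ann R X = right_ann R X"
  unfolding left_ann_def right_ann_def by (auto intro: reversible)

lemma right_ann_principal:
  assumes a: "a \<in> carrier R"
  shows "right_ann R (right_ideal_gen R {a}) = right_ann R {a}"
proof -
  have "\<exists>s\<in>carrier R. a = a \<otimes> s" using a by (metis one_closed r_one)
  then show ?thesis
    using a by (auto simp: right_ideal_gen_singleton right_ann_def intro: insert_middle)
qed

lemma left_ann_principal:
  assumes a: "a \<in> carrier R"
  shows "left_ann R (left_ideal_gen R {a}) = right_ann R {a}"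
proof -
  have "\<exists>s\<in>carrier R. a = s \<otimes> a" using a by (metis one_closed l_one)
  moreover have "c \<otimes> (s \<otimes> a) = \<zero>" if "c \<in> carrier R" "s \<in> carrier R" "a \<otimes> c = \<zero>" for c s
    using that a insert_middle[of c a s] reversible[of a c] by (simp add: m_assoc)
  ultimately show ?thesis
    using a by (auto simp: left_ideal_gen_singleton left_ann_def right_ann_def intro: reversible)
qed

text \<open>
  The double annihilator is a right ideal with the same right annihilator as \<open>X\<close>.  It lets
  conditions on right ideals be applied to arbitrary sets.
\<close>

lemma right_ideal_double_ann:
  assumes "X \<subseteq> carrier R"
  shows "right_ideal (left_ann R (right_ann R X)) R"
    and "right_ann R (left_ann R (right_ann R X)) = right_ann R X"
proof -
  let ?Y = "right_ann R X"
  have Y: "?Y \<subseteq> carrier R" by (auto simp: right_ann_def)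
  have "additive_subgroup (left_ann R ?Y) R"
    by (rule additive_subgroup.intro, rule add.subgroupI)
       (use Y in \<open>auto simp: left_ann_def l_distr l_minus subset_iff intro!: exI[of _ \<zero>]\<close>)
  then show "right_ideal (left_ann R ?Y) R"
    using Y by (auto simp: right_ideal_def left_ann_def intro: insert_middle)
  show "right_ann R (left_ann R ?Y) = ?Y"
    using assms by (auto simp: right_ann_def left_ann_def)
qed

lemma Baer_ring_iff:
  "Baer_ring R \<longleftrightarrow> (\<forall>X \<subseteq> carrier R. idempotent_annihilator R X)"
proof -
  have "right_ann R {} = right_ann R {\<zero>}" by (auto simp: right_ann_def)
  then have "idempotent_annihilator R {} = idempotent_annihilator R {\<zero>}"
    by (simp add: idempotent_annihilator_def)
  then show ?thesis
    unfolding Baer_ring_def idempotent_annihilator_def[symmetric]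
    using ring_axioms by (metis empty_not_insert empty_subsetI insert_subset zero_closed)
qed

lemma quasi_Baer_ring_iff:
  "quasi_Baer_ring R \<longleftrightarrow> (\<forall>X \<subseteq> carrier R. idempotent_annihilator R X)"
proof -
  have "I \<subseteq> carrier R" if "right_ideal I R" for I
    using that by (simp add: right_ideal_def additive_subgroup.a_subset)
  moreover have "idempotent_annihilator R X"
    if "\<forall>I. right_ideal I R \<longrightarrow> idempotent_annihilator R I" "X \<subseteq> carrier R" for X
    using that right_ideal_double_ann[of X] unfolding idempotent_annihilator_def by metis
  ultimately show ?thesis
    unfolding quasi_Baer_ring_def idempotent_annihilator_def[symmetric]
    using ring_axioms by blast
qed

lemma pq_Baer_ring_iff:
  "pq_Baer_ring R \<longleftrightarrow> (\<forall>a \<in> carrier R. idempotent_annihilator R {a})"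
  unfolding pq_Baer_ring_def right_pq_Baer_ring_def left_pq_Baer_ring_def
    idempotent_annihilator_def
  using ring_axioms
  by (simp add: right_ann_principal left_ann_principal idempotent_left_ideal_gen)

text \<open>
  If \<open>a a = 0\<close> and the annihilator of \<open>a\<close> is \<open>e R\<close>, then \<open>a\<close> lies in \<open>e R\<close>, so \<open>a = e a = a e = 0\<close>.
\<close>

lemma reduced_if_idempotent_annihilators:
  assumes "\<And>a. a \<in> carrier R \<Longrightarrow> idempotent_annihilator R {a}"
    and a: "a \<in> carrier R" "a \<otimes> a = \<zero>"
  shows "a = \<zero>"
proof -
  obtain e where e: "e \<in> idempotents R" "right_ann R {a} = right_ideal_gen R {e}"
    using assms unfolding idempotent_annihilator_def by blast
  then have ann: "right_ann R {a} = {s \<in> carrier R. e \<otimes> s = s}"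
    by (simp add: idempotent_right_ideal_gen)
  have "a \<in> right_ann R {a}" using a by (simp add: right_ann_def)
  then have "e \<otimes> a = a" using ann by simp
  moreover have "e \<in> right_ann R {a}" using e(1) ann by (simp add: idempotents_def)
  then have "a \<otimes> e = \<zero>" by (simp add: right_ann_def)
  ultimately show ?thesis using idempotent_central[OF e(1) a(1)] by simp
qed

text \<open>
  As idempotents are central, \<open>e R \<inter> e' R = e e' R\<close>; the empty set has annihilator \<open>1 R\<close>.
\<close>

lemma idempotent_annihilator_finite:
  assumes single: "\<And>a. a \<in> carrier R \<Longrightarrow> idempotent_annihilator R {a}"
    and "finite C" "C \<subseteq> carrier R"
  shows "idempotent_annihilator R C"
  using assms(2,3)
proof (induction C rule: finite_induct)
  case empty
  have "\<one> \<in> idempotents R" by (simp add: idempotents_def)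
  moreover from this have "right_ann R {} = right_ideal_gen R {\<one>}"
    by (auto simp: right_ann_def idempotent_right_ideal_gen)
  ultimately show ?case unfolding idempotent_annihilator_def by blast
next
  case (insert a C)
  then obtain e where e: "e \<in> idempotents R" "right_ann R C = right_ideal_gen R {e}"
    unfolding idempotent_annihilator_def by auto
  obtain e' where e': "e' \<in> idempotents R" "right_ann R {a} = right_ideal_gen R {e'}"
    using single[of a] insert.prems unfolding idempotent_annihilator_def by auto
  have c: "e \<in> carrier R" "e \<otimes> e = e" "e' \<in> carrier R" "e' \<otimes> e' = e'"
    using e(1) e'(1) by (auto simp: idempotents_def)
  have comm: "e \<otimes> e' = e' \<otimes> e" using idempotent_central[OF e(1)] c(3) .
  have absorb: "e \<otimes> (e \<otimes> s) = e \<otimes> s" "e' \<otimes> (e' \<otimes> s) = e' \<otimes> s"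
    "e' \<otimes> (e \<otimes> s) = e \<otimes> (e' \<otimes> s)" if "s \<in> carrier R" for s
    using that c comm m_assoc by metis+
  have "e \<otimes> e' \<in> idempotents R"
    using c absorb by (simp add: idempotents_def m_assoc)
  moreover have "right_ann R (insert a C) = right_ann R {a} \<inter> right_ann R C"
    by (auto simp: right_ann_def)
  moreover have "(e' \<otimes> s = s \<and> e \<otimes> s = s) \<longleftrightarrow> e \<otimes> e' \<otimes> s = s" if "s \<in> carrier R" for s
    using that c absorb[OF that] absorb[of "e' \<otimes> s"] by (metis m_assoc m_closed)
  ultimately have "right_ann R (insert a C) = right_ideal_gen R {e \<otimes> e'}"
    using e e' by (auto simp: idempotent_right_ideal_gen)
  then show ?case
    using \<open>e \<otimes> e' \<in> idempotents R\<close> unfolding idempotent_annihilator_def by blast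
qed

end

text \<open>If \<open>a b = 0\<close>, then \<open>(b a)\<^sup>2 = b (a b) a = 0\<close>.\<close>

lemma (in ring) reversible_ring_if_reduced:
  assumes "\<And>a. a \<in> carrier R \<Longrightarrow> a \<otimes> a = \<zero> \<Longrightarrow> a = \<zero>"
  shows "reversible_ring R"
proof
  fix a b assume ab: "a \<in> carrier R" "b \<in> carrier R" "a \<otimes> b = \<zero>"
  have "b \<otimes> a \<otimes> (b \<otimes> a) = b \<otimes> (a \<otimes> b) \<otimes> a" using ab(1,2) by (simp add: m_assoc)
  also have "\<dots> = \<zero>" using ab by simp
  finally show "b \<otimes> a = \<zero>" using ab assms[of "b \<otimes> a"] by simp
qed

section \<open>Ore extensions of reduced rings\<close>

locale reduced_compatible_ore = ore_data +
  assumes reduced: "a \<in> carrier R \<Longrightarrow> a \<otimes> a = \<zero> \<Longrightarrow> a = \<zero>"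
    and sigma_compatible:
      "a \<in> carrier R \<Longrightarrow> b \<in> carrier R \<Longrightarrow> a \<otimes> \<sigma> b = \<zero> \<longleftrightarrow> a \<otimes> b = \<zero>"
begin

sublocale reversible_ring R
  by (rule reversible_ring_if_reduced) (rule reduced)

text \<open>
  Apply \<open>\<delta>\<close> to \<open>a b = 0\<close> and multiply by \<open>b\<close> from the left.  The term \<open>b \<sigma>(a) \<delta>(b)\<close> vanishes, so
  \<open>b \<delta>(a) b = 0\<close>, which forces \<open>\<delta>(a) b = 0\<close>.  What remains is \<open>\<sigma>(a) \<delta>(b) = 0\<close>,
  and \<open>\<sigma>\<close> disappears after reversing.
\<close>

lemma delta_compatible:
  assumes "a \<in> carrier R" "b \<in> carrier R" "a \<otimes> b = \<zero>"
  shows "a \<otimes> \<delta> b = \<zero>"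
proof -
  have "b \<otimes> a = \<zero>" using assms reversible by blast
  then have "b \<otimes> \<sigma> a = \<zero>" using assms by (simp add: sigma_compatible)
  have eq: "\<sigma> a \<otimes> \<delta> b \<oplus> \<delta> a \<otimes> b = \<zero>"
    using d_mult[OF assms(1,2)] assms(3) by simp
  have "b \<otimes> \<sigma> a \<otimes> \<delta> b \<oplus> b \<otimes> (\<delta> a \<otimes> b) = b \<otimes> (\<sigma> a \<otimes> \<delta> b \<oplus> \<delta> a \<otimes> b)"
    using assms by (simp add: r_distr m_assoc)
  then have "b \<otimes> (\<delta> a \<otimes> b) = \<zero>"
    using \<open>b \<otimes> \<sigma> a = \<zero>\<close> eq assms by simp
  then have "(\<delta> a \<otimes> b) \<otimes> (\<delta> a \<otimes> b) = \<zero>" using assms by (simp add: m_assoc)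
  then have "\<delta> a \<otimes> b = \<zero>" using assms reduced[of "\<delta> a \<otimes> b"] by simp
  then have "\<sigma> a \<otimes> \<delta> b = \<zero>" using eq assms by simp
  then have "\<delta> b \<otimes> \<sigma> a = \<zero>" using assms reversible[of "\<sigma> a" "\<delta> b"] by simp
  then have "\<delta> b \<otimes> a = \<zero>" using assms by (simp add: sigma_compatible)
  then show ?thesis using assms reversible[of "\<delta> b" a] by simp
qed

lemma sigma_power_closed: "b \<in> carrier R \<Longrightarrow> (\<sigma> ^^ i) b \<in> carrier R"
  by (induction i) auto

lemma sigma_power_compatible:
  assumes "a \<in> carrier R" "b \<in> carrier R"
  shows "a \<otimes> (\<sigma> ^^ i) b = \<zero> \<longleftrightarrow> a \<otimes> b = \<zero>"
  using assms by (induction i) (auto simp: sigma_compatible sigma_power_closed)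

text \<open>The coefficients of \<open>x\<^sup>i g\<close> are sums of words in \<open>\<sigma>\<close> and \<open>\<delta>\<close> applied to coefficients of \<open>g\<close>.\<close>

lemma annihilates_T_power:
  assumes "a \<in> carrier R" "g \<in> up R" "\<And>j. a \<otimes> g j = \<zero>"
  shows "a \<otimes> (T ^^ i) g j = \<zero>"
proof (induction i arbitrary: j)
  case (Suc i)
  then show ?case
    using assms(1,2)
    by (cases j) (simp_all add: T_0 T_Suc r_distr sigma_compatible delta_compatible)
qed (use assms in simp)

lemma M_eq_zero_if_coeffs:
  assumes "f \<in> up R" "g \<in> up R" "\<And>i j. f i \<otimes> g j = \<zero>"
  shows "M f g = (\<lambda>n. \<zero>)"
proof
  show "M f g n = \<zero>" for n
    unfolding ore_mult_def
    by (rule add.finprod_one_eqI) (use assms in \<open>simp add: annihilates_T_power\<close>)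
qed

lemma T_power_above:
  assumes "\<forall>j>m. g j = \<zero>" "m + i < j"
  shows "(T ^^ i) g j = \<zero>"
  using assms(2)
proof (induction i arbitrary: j)
  case (Suc i)
  then show ?case by (cases j) (simp_all add: T_Suc)
qed (use assms(1) in simp)

lemma T_power_lead:
  assumes "g \<in> up R" "\<forall>j>m. g j = \<zero>"
  shows "(T ^^ i) g (m + i) = (\<sigma> ^^ i) (g m)"
proof (induction i)
  case (Suc i)
  then show ?case
    using assms by (simp add: T_Suc T_power_above[OF assms(2)] sigma_power_closed)
qed simp

lemma M_lead:
  assumes fg: "f \<in> up R" "g \<in> up R" and f: "\<forall>i>n. f i = \<zero>" and g: "\<forall>j>m. g j = \<zero>"
  shows "M f g (m + n) = f n \<otimes> (\<sigma> ^^ n) (g m)"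
proof -
  have "bound \<zero> n f" using f by (auto simp: bound_def)
  then have "M f g (m + n) = (\<Oplus>i\<in>{..n}. f i \<otimes> (T ^^ i) g (m + n))"
    using fg by (simp add: M_bound)
  also have "\<dots> = (\<Oplus>i\<in>{..n}. if n = i then f i \<otimes> (T ^^ i) g (m + n) else \<zero>)"
    using fg by (intro add.finprod_cong') (auto simp: T_power_above[OF g])
  also have "\<dots> = f n \<otimes> (T ^^ n) g (m + n)"
    using fg by (subst add.finprod_singleton) auto
  finally show ?thesis by (simp add: T_power_lead[OF fg(2) g])
qed

text \<open>
  The proof is an induction on \<open>n + m\<close>.  Let \<open>a\<close> and \<open>b\<close> be the coefficients of \<open>f\<close> and \<open>g\<close> in the
  top degrees \<open>n' = n - 1\<close> and \<open>m' = m - 1\<close>.  The top coefficient of the product is \<open>a \<sigma>\<^sup>k(b)\<close> with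
  \<open>k = n'\<close>, so \<open>a b = b a = 0\<close> and the degree bound of \<open>b f\<close> is smaller.  As \<open>(b f) g = 0\<close>, the
  induction hypothesis gives \<open>b f\<^sub>i b = 0\<close>, and then \<open>f\<^sub>i b = 0\<close> because \<open>R\<close> is reduced, for every
  \<open>i\<close>.  Therefore \<open>f\<close> annihilates the top term of \<open>g\<close>, which can be removed.
\<close>

lemma coeffs_annihilate_if_M_eq_zero:
  assumes "f \<in> up R" "g \<in> up R" "M f g = (\<lambda>n. \<zero>)" "\<forall>i\<ge>n. f i = \<zero>" "\<forall>j\<ge>m. g j = \<zero>"
  shows "f i \<otimes> g j = \<zero>"
  using assms
proof (induction "n + m" arbitrary: n m f g i j rule: less_induct)
  case less
  note fg = less.prems(1,2)
  show ?case
  proof (cases "n = 0 \<or> m = 0")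
    case True
    then show ?thesis using less.prems by auto
  next
    case False
    then obtain n' m' where nm: "n = Suc n'" "m = Suc m'" by (metis not0_implies_Suc)
    let ?b = "g m'"
    have b: "?b \<in> carrier R" using fg by simp
    have "f n' \<otimes> (\<sigma> ^^ n') ?b = M f g (m' + n')"
      using less.prems nm by (intro M_lead[symmetric]) auto
    then have "f n' \<otimes> ?b = \<zero>"
      using less.prems(3) fg by (simp add: sigma_power_compatible)
    then have "?b \<otimes> f n' = \<zero>" using fg reversible[of "f n'" ?b] by simp
    then have bf: "\<forall>i\<ge>n'. S ?b f i = \<zero>"
      using less.prems(4) nm b by (metis Suc_leI le_neq_implies_less r_null)
    have "M (S ?b f) g = (\<lambda>n. \<zero>)"
      using fg less.prems(3) by (simp add: M_S)
    then have "S ?b f i \<otimes> ?b = \<zero>" for i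
      using less.hyps[of n' m "S ?b f" g] bf less.prems nm by simp
    then have "?b \<otimes> f i \<otimes> ?b = \<zero>" for i by simp
    then have "f i \<otimes> ?b \<otimes> (f i \<otimes> ?b) = \<zero>" for i using fg by (simp add: m_assoc)
    then have fb: "f i \<otimes> ?b = \<zero>" for i using fg b reduced[of "f i \<otimes> ?b"] by simp
    let ?g = "\<lambda>j. if j < m' then g j else \<zero>"
    have g': "?g \<in> up R"
    proof (rule mem_upI)
      show "?g k \<in> carrier R" for k using fg by simp
      have "bound \<zero> m' ?g" by (auto simp: bound_def)
      then show "\<exists>k. bound \<zero> k ?g" by blast
    qed
    have split: "g = A ?g (mnm ?b m')"
    proof
      fix k
      show "g k = ?g k \<oplus> mnm ?b m' k"
        using less.prems nm by (cases k m' rule: linorder_cases) auto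
    qed
    have "M f (mnm ?b m') = (\<lambda>n. \<zero>)"
      using fg fb b by (intro M_eq_zero_if_coeffs) auto
    moreover have "M f g = A (M f ?g) (M f (mnm ?b m'))"
      using M_A_right[OF fg(1) g' mon_up[OF b]] arg_cong[OF split, of "M f"] by (rule trans[rotated])
    ultimately have "M f ?g = (\<lambda>n. \<zero>)"
      using less.prems(3) fg(1) g' by (simp add: fun_eq_iff)
    then have "f i \<otimes> ?g j = \<zero>"
      using less.hyps[of n m' f ?g] g' less.prems nm by simp
    then show ?thesis
      using fb[of i] fg less.prems(5) nm
      by (cases j m' rule: linorder_cases) auto
  qed
qed

lemma M_eq_zero_iff:
  assumes "f \<in> up R" "g \<in> up R"
  shows "M f g = (\<lambda>n. \<zero>) \<longleftrightarrow> (\<forall>i j. f i \<otimes> g j = \<zero>)"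
proof -
  obtain n m where "bound \<zero> n f" "bound \<zero> m g" using assms by blast
  then have "\<forall>i\<ge>Suc n. f i = \<zero>" "\<forall>j\<ge>Suc m. g j = \<zero>" by (auto simp: bound_def)
  then show ?thesis
    using coeffs_annihilate_if_M_eq_zero[OF assms] M_eq_zero_if_coeffs[OF assms] by blast
qed

lemma carrier_E: "carrier E = up R"
  and mult_E: "f \<otimes>\<^bsub>E\<^esub> g = M f g"
  and zero_E: "\<zero>\<^bsub>E\<^esub> = (\<lambda>n. \<zero>)"
  by (simp_all add: ore_extension_def UP_def)

text \<open>Reducedness passes to the Ore extension: if \<open>f f = 0\<close>, then \<open>f\<^sub>i f\<^sub>i = 0\<close> for every \<open>i\<close>.\<close>

lemma reversible_ring_E: "reversible_ring E"
proof (rule ring.reversible_ring_if_reduced[OF ring_E])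
  fix f assume f: "f \<in> carrier E" "f \<otimes>\<^bsub>E\<^esub> f = \<zero>\<^bsub>E\<^esub>"
  then have "f i \<otimes> f i = \<zero>" for i by (simp add: carrier_E mult_E zero_E M_eq_zero_iff)
  then have "f i = \<zero>" for i using f(1) reduced[of "f i"] by (simp add: carrier_E)
  then show "f = \<zero>\<^bsub>E\<^esub>" by (simp add: zero_E fun_eq_iff)
qed

lemma idempotent_annihilator_E:
  assumes X: "X \<subseteq> carrier E"
    and ann: "idempotent_annihilator R (\<Union>f\<in>X. range f)"
  shows "idempotent_annihilator E X"
proof -
  obtain e where e: "e \<in> idempotents R"
    and C: "right_ann R (\<Union>f\<in>X. range f) = right_ideal_gen R {e}"
    using ann unfolding idempotent_annihilator_def by blast
  have ec: "e \<in> carrier R" "e \<otimes> e = e" using e by (auto simp: idempotents_def)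
  have "mnm e 0 \<in> idempotents E"
    using ec by (auto simp: idempotents_def carrier_E mult_E M_mnm)
  moreover have "right_ann E X = right_ideal_gen E {mnm e 0}"
  proof -
    have "g \<in> right_ann E X \<longleftrightarrow> S e g = g" if g: "g \<in> up R" for g
    proof -
      have "g \<in> right_ann E X \<longleftrightarrow> (\<forall>f\<in>X. \<forall>i j. f i \<otimes> g j = \<zero>)"
        using g X by (auto simp: right_ann_def carrier_E mult_E zero_E M_eq_zero_iff subset_iff)
      also have "\<dots> \<longleftrightarrow> (\<forall>j. g j \<in> right_ann R (\<Union>f\<in>X. range f))"
        using g by (auto simp: right_ann_def)
      also have "\<dots> \<longleftrightarrow> (\<forall>j. e \<otimes> g j = g j)"
        using g by (simp add: C idempotent_right_ideal_gen[OF e])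
      finally show ?thesis by (simp add: fun_eq_iff)
    qed
    moreover have "right_ann E X \<subseteq> up R" by (auto simp: right_ann_def carrier_E)
    moreover have "right_ideal_gen E {mnm e 0} = {g \<in> up R. S e g = g}"
      using reversible_ring.idempotent_right_ideal_gen[OF reversible_ring_E]
        \<open>mnm e 0 \<in> idempotents E\<close> ec
      by (auto simp: carrier_E mult_E M_mnm)
    ultimately show ?thesis by blast
  qed
  ultimately show ?thesis unfolding idempotent_annihilator_def by blast
qed

lemma idempotent_annihilators_E:
  assumes "\<forall>C \<subseteq> carrier R. idempotent_annihilator R C"
  shows "\<forall>X \<subseteq> carrier E. idempotent_annihilator E X"
proof (intro allI impI)
  fix X assume X: "X \<subseteq> carrier E"
  then have "(\<Union>f\<in>X. range f) \<subseteq> carrier R"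
    unfolding carrier_E by (blast intro: upc)
  then show "idempotent_annihilator E X"
    using assms idempotent_annihilator_E[OF X] by blast
qed

lemma Baer_ring_E: "Baer_ring R \<Longrightarrow> Baer_ring E"
  using idempotent_annihilators_E
  by (simp add: Baer_ring_iff reversible_ring.Baer_ring_iff[OF reversible_ring_E])

lemma quasi_Baer_ring_E: "quasi_Baer_ring R \<Longrightarrow> quasi_Baer_ring E"
  using idempotent_annihilators_E
  by (simp add: quasi_Baer_ring_iff reversible_ring.quasi_Baer_ring_iff[OF reversible_ring_E])

lemma pq_Baer_ring_E:
  assumes "pq_Baer_ring R"
  shows "pq_Baer_ring E"
  unfolding reversible_ring.pq_Baer_ring_iff[OF reversible_ring_E]
proof
  fix f assume "f \<in> carrier E"
  then have f: "f \<in> up R" by (simp add: carrier_E)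
  obtain n where "bound \<zero> n f" using f by blast
  then have "range f \<subseteq> insert \<zero> (f ` {..n})"
    by (auto simp: bound_def) (metis atMost_iff imageI not_le)
  then have "finite (range f)" by (rule finite_subset) simp
  moreover have "range f \<subseteq> carrier R" using f by (blast intro: upc)
  moreover have "\<forall>a \<in> carrier R. idempotent_annihilator R {a}"
    using assms unfolding pq_Baer_ring_iff .
  ultimately have "idempotent_annihilator R (range f)"
    by (blast intro: idempotent_annihilator_finite)
  then show "idempotent_annihilator E {f}"
    using f by (intro idempotent_annihilator_E) (simp_all add: carrier_E)
qed

end

section \<open>Baer-type conditions pass to the Ore extension\<close>

theorem theorem4p2:
  fixes R :: "('a, 'm) ring_scheme" and \<sigma> \<delta> :: "'a \<Rightarrow> 'a"
  assumes "ring R"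
    and "\<sigma> \<in> ring_hom R R"
    and "sigma_derivation R \<sigma> \<delta>"
    and "right_sigma_reversible R \<sigma>"
    and "condition_C R \<sigma>"
  shows "(Baer_ring R \<longrightarrow> Baer_ring (ore_extension R \<sigma> \<delta>)) \<and>
         (quasi_Baer_ring R \<longrightarrow> quasi_Baer_ring (ore_extension R \<sigma> \<delta>)) \<and>
         (pq_Baer_ring R \<longrightarrow> pq_Baer_ring (ore_extension R \<sigma> \<delta>))"
proof -
  interpret ore_data R \<sigma> \<delta>
    using assms by (intro ore_data.intro ore_data_axioms.intro)
  have sigma_rev: "b \<otimes>\<^bsub>R\<^esub> \<sigma> a = \<zero>\<^bsub>R\<^esub>"
    if "a \<in> carrier R" "b \<in> carrier R" "a \<otimes>\<^bsub>R\<^esub> b = \<zero>\<^bsub>R\<^esub>" for a b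
    using that assms(4) by (simp add: right_sigma_reversible_def)
  have drop_sigma: "a \<otimes>\<^bsub>R\<^esub> b = \<zero>\<^bsub>R\<^esub>"
    if "a \<in> carrier R" "b \<in> carrier R" "a \<otimes>\<^bsub>R\<^esub> \<sigma> b = \<zero>\<^bsub>R\<^esub>" for a b
    using that assms(5) by (simp add: condition_C_def)
  interpret reversible_ring R
    by unfold_locales (blast intro: sigma_rev drop_sigma)
  have "reduced_compatible_ore R \<sigma> \<delta>"
    if "\<forall>a \<in> carrier R. idempotent_annihilator R {a}"
    using that
    by unfold_locales
      (blast intro: reduced_if_idempotent_annihilators sigma_rev drop_sigma reversible)+
  moreover have "\<forall>a \<in> carrier R. idempotent_annihilator R {a}"
    if "Baer_ring R \<or> quasi_Baer_ring R \<or> pq_Baer_ring R"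
    using that by (auto simp: Baer_ring_iff quasi_Baer_ring_iff pq_Baer_ring_iff)
  ultimately have "reduced_compatible_ore R \<sigma> \<delta>"
    if "Baer_ring R \<or> quasi_Baer_ring R \<or> pq_Baer_ring R"
    using that by simp
  then show ?thesis
    using reduced_compatible_ore.Baer_ring_E[of R \<sigma> \<delta>]
      reduced_compatible_ore.quasi_Baer_ring_E[of R \<sigma> \<delta>]
      reduced_compatible_ore.pq_Baer_ring_E[of R \<sigma> \<delta>]
    by simp
qed

end
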